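(* Let $k$ be a commutative ring, let $\mathcal B$ be a $k$-category equipped with a grading $X$ by a group $\Gamma$, and let $\mathcal B\#\Gamma$ be the associated smash product category. Then $\mathcal B\#\Gamma$ is a connected $k$-category if and only if the $\Gamma$-grading of $\mathcal B$ is connected.
   Context: A $k$-category is a small category $\mathcal B$ whose morphism sets ${}_y\mathcal B_x$ (morphisms from $x$ to $y$) are $k$-modules with $k$-bilinear composition. A non-zero walk in $\mathcal B$ from $x$ to $y$ is a sequence $(f_n,\epsilon_n)\cdots(f_1,\epsilon_1)$ of non-zero morphisms with signs $\epsilon_i\in\{1,-1\}$ such that $s(f_{i+1},\epsilon_{i+1})=t(f_i,\epsilon_i)$, $s(f_1,\epsilon_1)=x$, $t(f_n,\epsilon_n)=y$, where $s(f,1)=s(f)=t(f,-1)$ is the source of $f$ and $t(f,1)=t(f)=s(f,-1)$ its target. $\mathcal B$ is connected if any two objects are joined by a non-zero walk. A grading $X$ of $\mathcal B$ by a group $\Gamma$ is a direct sum decomposition ${}_y\mathcal B_x=\bigoplus_{s\in\Gamma}X^s({}_y\mathcal B_x)$ for all objects $x,y$, such that $X^t({}_z\mathcal B_y)X^s({}_y\mathcal B_x)\subset X^{ts}({}_z\mathcal B_x)$. A non-zero walk is homogeneous if all its morphisms are homogeneous, and its degree is then $(\deg f_n)^{\epsilon_n}\cdots(\deg f_1)^{\epsilon_1}$. The grading is connected if for any two objects and any $g\in\Gamma$ the two objects can be joined by a non-zero homogeneous walk of degree $g$. The smash product category $\mathcal B\#\Gamma$ has object set $\mathcal B_0\times\Gamma$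 ($\mathcal B_0$ being the objects of $\mathcal B$); the module of morphisms from $(b,g)$ to $(c,h)$ is $X^{h^{-1}g}({}_c\mathcal B_b)$; composition is that of $\mathcal B$. *)

theory Defs
  imports "HOL-Algebra.Module"
begin

text \<open>Arguments of \<open>Hom\<close>, \<open>cmp\<close> (and of a grading, below) follow the notation
  \<open>\<^sub>y\<B>\<^sub>x\<close>: \<open>Hom \<B> y x\<close> is the module of morphisms from \<open>x\<close> to \<open>y\<close>, and \<open>cmp \<B> z y x g f\<close>
  is the composite \<open>g f\<close> of \<open>f\<close> from \<open>x\<close> to \<open>y\<close> with \<open>g\<close> from \<open>y\<close> to \<open>z\<close>.
  The library's record for modules extends that for rings; the locale for modules ignores
  its multiplicative fields.\<close>

record ('k, 'o, 'm) kcat =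
  Obj :: "'o set"
  Hom :: "'o \<Rightarrow> 'o \<Rightarrow> ('k, 'm) module"
  cmp :: "'o \<Rightarrow> 'o \<Rightarrow> 'o \<Rightarrow> 'm \<Rightarrow> 'm \<Rightarrow> 'm"
  Idn :: "'o \<Rightarrow> 'm"

locale k_category = cring K
  for K :: "('k, 'r) ring_scheme" and \<B> :: "('k, 'o, 'm) kcat" +
  assumes hom_module:
      "\<lbrakk>x \<in> Obj \<B>; y \<in> Obj \<B>\<rbrakk> \<Longrightarrow> module K (Hom \<B> y x)"
    and cmp_closed:
      "\<lbrakk>x \<in> Obj \<B>; y \<in> Obj \<B>; z \<in> Obj \<B>;
        f \<in> carrier (Hom \<B> y x); g \<in> carrier (Hom \<B> z y)\<rbrakk>
       \<Longrightarrow> cmp \<B> z y x g f \<in> carrier (Hom \<B> z x)"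
    and cmp_add_right:
      "\<lbrakk>x \<in> Obj \<B>; y \<in> Obj \<B>; z \<in> Obj \<B>;
        f \<in> carrier (Hom \<B> y x); f' \<in> carrier (Hom \<B> y x); g \<in> carrier (Hom \<B> z y)\<rbrakk>
       \<Longrightarrow> cmp \<B> z y x g (f \<oplus>\<^bsub>Hom \<B> y x\<^esub> f')
           = cmp \<B> z y x g f \<oplus>\<^bsub>Hom \<B> z x\<^esub> cmp \<B> z y x g f'"
    and cmp_add_left:
      "\<lbrakk>x \<in> Obj \<B>; y \<in> Obj \<B>; z \<in> Obj \<B>;
        f \<in> carrier (Hom \<B> y x); g \<in> carrier (Hom \<B> z y); g' \<in> carrier (Hom \<B> z y)\<rbrakk>
       \<Longrightarrow> cmp \<B> z y x (g \<oplus>\<^bsub>Hom \<B> z y\<^esub> g') f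
           = cmp \<B> z y x g f \<oplus>\<^bsub>Hom \<B> z x\<^esub> cmp \<B> z y x g' f"
    and cmp_smult_right:
      "\<lbrakk>x \<in> Obj \<B>; y \<in> Obj \<B>; z \<in> Obj \<B>; a \<in> carrier K;
        f \<in> carrier (Hom \<B> y x); g \<in> carrier (Hom \<B> z y)\<rbrakk>
       \<Longrightarrow> cmp \<B> z y x g (a \<odot>\<^bsub>Hom \<B> y x\<^esub> f) = a \<odot>\<^bsub>Hom \<B> z x\<^esub> cmp \<B> z y x g f"
    and cmp_smult_left:
      "\<lbrakk>x \<in> Obj \<B>; y \<in> Obj \<B>; z \<in> Obj \<B>; a \<in> carrier K;
        f \<in> carrier (Hom \<B> y x); g \<in> carrier (Hom \<B> z y)\<rbrakk>
       \<Longrightarrow> cmp \<B> z y x (a \<odot>\<^bsub>Hom \<B> z y\<^esub> g) f = a \<odot>\<^bsub>Hom \<B> z x\<^esub> cmp \<B> z y x g f"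
    and cmp_assoc:
      "\<lbrakk>w \<in> Obj \<B>; x \<in> Obj \<B>; y \<in> Obj \<B>; z \<in> Obj \<B>;
        f \<in> carrier (Hom \<B> x w); g \<in> carrier (Hom \<B> y x); h \<in> carrier (Hom \<B> z y)\<rbrakk>
       \<Longrightarrow> cmp \<B> z x w (cmp \<B> z y x h g) f = cmp \<B> z y w h (cmp \<B> y x w g f)"
    and Idn_closed:
      "x \<in> Obj \<B> \<Longrightarrow> Idn \<B> x \<in> carrier (Hom \<B> x x)"
    and cmp_Idn_left:
      "\<lbrakk>x \<in> Obj \<B>; y \<in> Obj \<B>; f \<in> carrier (Hom \<B> y x)\<rbrakk>
       \<Longrightarrow> cmp \<B> y y x (Idn \<B> y) f = f"
    and cmp_Idn_right:
      "\<lbrakk>x \<in> Obj \<B>; y \<in> Obj \<B>; f \<in> carrier (Hom \<B> y x)\<rbrakk>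
       \<Longrightarrow> cmp \<B> y x x f (Idn \<B> x) = f"

text \<open>Distinct modules \<open>Hom \<B> y x\<close> may share elements (they do in the smash product), so a
  morphism on a walk is an element together with its source and target.\<close>

datatype ('o, 'm) arrow = Arrow (source: 'o) (target: 'o) (mor: 'm)

definition nonzero_morphism :: "('k, 'o, 'm) kcat \<Rightarrow> ('o, 'm) arrow \<Rightarrow> bool" where
  "nonzero_morphism \<B> f \<longleftrightarrow>
     source f \<in> Obj \<B> \<and> target f \<in> Obj \<B> \<and>
     mor f \<in> carrier (Hom \<B> (target f) (source f)) \<and>
     mor f \<noteq> \<zero>\<^bsub>Hom \<B> (target f) (source f)\<^esub>"

fun step_source :: "('o, 'm) arrow \<times> int \<Rightarrow> 'o" where
  "step_source (f, \<epsilon>) = (if \<epsilon> = 1 then source f else target f)"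

fun step_target :: "('o, 'm) arrow \<times> int \<Rightarrow> 'o" where
  "step_target (f, \<epsilon>) = (if \<epsilon> = 1 then target f else source f)"

text \<open>A walk is listed as it is written, \<open>(f\<^sub>n, \<epsilon>\<^sub>n) \<dots> (f\<^sub>1, \<epsilon>\<^sub>1)\<close>: the first step
  to be travelled is the last element of the list. Walks have at least one step.\<close>

definition nonzero_walk ::
    "('k, 'o, 'm) kcat \<Rightarrow> (('o, 'm) arrow \<times> int) list \<Rightarrow> 'o \<Rightarrow> 'o \<Rightarrow> bool" where
  "nonzero_walk \<B> w x y \<longleftrightarrow>
     w \<noteq> [] \<and>
     (\<forall>(f, \<epsilon>) \<in> set w. nonzero_morphism \<B> f \<and> \<epsilon> \<in> {1, -1}) \<and>
     (\<forall>i. Suc i < length w \<longrightarrow> step_source (w ! i) = step_target (w ! Suc i)) \<and>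
     step_source (last w) = x \<and> step_target (hd w) = y"

definition connected_kcat :: "('k, 'o, 'm) kcat \<Rightarrow> bool" where
  "connected_kcat \<B> \<longleftrightarrow> (\<forall>x \<in> Obj \<B>. \<forall>y \<in> Obj \<B>. \<exists>w. nonzero_walk \<B> w x y)"

definition internal_direct_sum ::
    "('k, 'r) ring_scheme \<Rightarrow> ('k, 'm, 'n) module_scheme \<Rightarrow> 'i set \<Rightarrow> ('i \<Rightarrow> 'm set) \<Rightarrow> bool" where
  "internal_direct_sum K M I N \<longleftrightarrow>
     (\<forall>i \<in> I. submodule (N i) K M) \<and>
     (\<forall>m \<in> carrier M. \<exists>!c. c \<in> (\<Pi>\<^sub>E i \<in> I. N i) \<and>
        finite {i \<in> I. c i \<noteq> \<zero>\<^bsub>M\<^esub>} \<and>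
        m = (\<Oplus>\<^bsub>M\<^esub>i \<in> {i \<in> I. c i \<noteq> \<zero>\<^bsub>M\<^esub>}. c i))"

text \<open>\<open>\<X> s y x\<close> is the component of degree \<open>s\<close> of \<open>Hom \<B> y x\<close>.\<close>

locale grading = k_category K \<B> + \<Gamma>: group \<Gamma>
  for K :: "('k, 'r) ring_scheme" and \<B> :: "('k, 'o, 'm) kcat"
    and \<Gamma> :: "('g, 'h) monoid_scheme" and \<X> :: "'g \<Rightarrow> 'o \<Rightarrow> 'o \<Rightarrow> 'm set" +
  assumes decomposition:
      "\<lbrakk>x \<in> Obj \<B>; y \<in> Obj \<B>\<rbrakk>
       \<Longrightarrow> internal_direct_sum K (Hom \<B> y x) (carrier \<Gamma>) (\<lambda>s. \<X> s y x)"
    and cmp_degree: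
      "\<lbrakk>x \<in> Obj \<B>; y \<in> Obj \<B>; z \<in> Obj \<B>; s \<in> carrier \<Gamma>; t \<in> carrier \<Gamma>;
        f \<in> \<X> s y x; g \<in> \<X> t z y\<rbrakk>
       \<Longrightarrow> cmp \<B> z y x g f \<in> \<X> (t \<otimes>\<^bsub>\<Gamma>\<^esub> s) z x"

definition homogeneous ::
    "('g, 'h) monoid_scheme \<Rightarrow> ('g \<Rightarrow> 'o \<Rightarrow> 'o \<Rightarrow> 'm set) \<Rightarrow> ('o, 'm) arrow \<Rightarrow> bool" where
  "homogeneous \<Gamma> \<X> f \<longleftrightarrow> (\<exists>s \<in> carrier \<Gamma>. mor f \<in> \<X> s (target f) (source f))"

text \<open>Meaningful for non-zero homogeneous morphisms, whose degree is unique.\<close>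

definition degree_of ::
    "('g, 'h) monoid_scheme \<Rightarrow> ('g \<Rightarrow> 'o \<Rightarrow> 'o \<Rightarrow> 'm set) \<Rightarrow> ('o, 'm) arrow \<Rightarrow> 'g" where
  "degree_of \<Gamma> \<X> f = (THE s. s \<in> carrier \<Gamma> \<and> mor f \<in> \<X> s (target f) (source f))"

definition homogeneous_walk ::
    "('g, 'h) monoid_scheme \<Rightarrow> ('g \<Rightarrow> 'o \<Rightarrow> 'o \<Rightarrow> 'm set) \<Rightarrow> (('o, 'm) arrow \<times> int) list \<Rightarrow> bool" where
  "homogeneous_walk \<Gamma> \<X> w \<longleftrightarrow> (\<forall>(f, \<epsilon>) \<in> set w. homogeneous \<Gamma> \<X> f)"

fun walk_deg ::
    "('g, 'h) monoid_scheme \<Rightarrow> ('g \<Rightarrow> 'o \<Rightarrow> 'o \<Rightarrow> 'm set) \<Rightarrow> (('o, 'm) arrow \<times> int) list \<Rightarrow> 'g" where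
  "walk_deg \<Gamma> \<X> [] = \<one>\<^bsub>\<Gamma>\<^esub>"
| "walk_deg \<Gamma> \<X> ((f, \<epsilon>) # w) = (degree_of \<Gamma> \<X> f [^]\<^bsub>\<Gamma>\<^esub> \<epsilon>) \<otimes>\<^bsub>\<Gamma>\<^esub> walk_deg \<Gamma> \<X> w"

definition connected_grading ::
    "('k, 'o, 'm) kcat \<Rightarrow> ('g, 'h) monoid_scheme \<Rightarrow> ('g \<Rightarrow> 'o \<Rightarrow> 'o \<Rightarrow> 'm set) \<Rightarrow> bool" where
  "connected_grading \<B> \<Gamma> \<X> \<longleftrightarrow>
     (\<forall>x \<in> Obj \<B>. \<forall>y \<in> Obj \<B>. \<forall>g \<in> carrier \<Gamma>.
        \<exists>w. nonzero_walk \<B> w x y \<and> homogeneous_walk \<Gamma> \<X> w \<and> walk_deg \<Gamma> \<X> w = g)"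

definition smash_product ::
    "('k, 'o, 'm) kcat \<Rightarrow> ('g, 'h) monoid_scheme \<Rightarrow> ('g \<Rightarrow> 'o \<Rightarrow> 'o \<Rightarrow> 'm set)
     \<Rightarrow> ('k, 'o \<times> 'g, 'm) kcat" where
  "smash_product \<B> \<Gamma> \<X> =
     \<lparr> Obj = Obj \<B> \<times> carrier \<Gamma>,
       Hom = (\<lambda>(c, h) (b, g).
         (Hom \<B> c b)\<lparr>carrier := \<X> (inv\<^bsub>\<Gamma>\<^esub> h \<otimes>\<^bsub>\<Gamma>\<^esub> g) c b\<rparr>),
       cmp = (\<lambda>(d, l) (c, h) (b, g). cmp \<B> d c b),
       Idn = (\<lambda>(b, g). Idn \<B> b) \<rparr>"

end

theory Submission
  imports Defs
begin

text \<open>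
  A non-zero morphism of the smash product from \<open>(b, g)\<close> to \<open>(c, h)\<close> is the same thing as a
  non-zero morphism of \<open>\<B>\<close> from \<open>b\<close> to \<open>c\<close> that is homogeneous of degree \<open>h\<inverse> g\<close>. Travelled
  with either sign, it contributes the factor \<open>t\<inverse> s\<close> to the degree of a walk, where \<open>s\<close> and
  \<open>t\<close> are the group components of the starting point and of the end point of the step. Along a
  walk of the smash product these factors telescope, so a walk from \<open>(x, g)\<close> to \<open>(y, h)\<close>
  projects to a homogeneous walk of degree \<open>h\<inverse> g\<close> from \<open>x\<close> to \<open>y\<close> (lemma \<open>project_walk\<close>).
  Conversely, the degrees dictate how a homogeneous walk lifts once the group component of its
  starting point is chosen, and the lift of a walk of degree \<open>d\<close> starting at \<open>(x, g)\<close> ends at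
  \<open>(y, g d\<inverse>)\<close> (lemma \<open>lift_walk\<close>). Since \<open>h\<inverse> g\<close> ranges over the whole group, the existence
  of walks between all pairs of objects of the smash product amounts to the existence of
  homogeneous walks of all degrees in \<open>\<B>\<close>.

  The smash product is a \<open>k\<close>-category for every grading (lemma \<open>smash_product_k_category\<close>).
  The axioms are inherited from \<open>\<B>\<close> or immediate from the definition of a grading, except that
  identities must belong to the smash product, that is, have degree \<open>1\<close> (lemma \<open>Idn_degree_one\<close>). This is a consequence of the
  uniqueness of homogeneous components: the component of degree \<open>1\<close> of the identity fixes
  every homogeneous endomorphism, hence every endomorphism, and in particular the identity.
\<close>

section \<open>Homogeneous components\<close>

lemma (in abelian_group) additive_map_finsum:
  assumes "abelian_group H"
    and closed: "\<And>a. a \<in> carrier G \<Longrightarrow> \<phi> a \<in> carrier H"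
    and add: "\<And>a b. a \<in> carrier G \<Longrightarrow> b \<in> carrier G \<Longrightarrow> \<phi> (a \<oplus>\<^bsub>G\<^esub> b) = \<phi> a \<oplus>\<^bsub>H\<^esub> \<phi> b"
    and "finite A" "u \<in> A \<rightarrow> carrier G"
  shows "\<phi> (\<Oplus>\<^bsub>G\<^esub>i\<in>A. u i) = (\<Oplus>\<^bsub>H\<^esub>i\<in>A. \<phi> (u i))"
proof -
  interpret H: abelian_group H by fact
  have "\<phi> \<zero>\<^bsub>G\<^esub> \<oplus>\<^bsub>H\<^esub> \<phi> \<zero>\<^bsub>G\<^esub> = \<phi> \<zero>\<^bsub>G\<^esub>"
    using add[of "\<zero>\<^bsub>G\<^esub>" "\<zero>\<^bsub>G\<^esub>"] by simp
  then have zero: "\<phi> \<zero>\<^bsub>G\<^esub> = \<zero>\<^bsub>H\<^esub>"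
    using closed[of "\<zero>\<^bsub>G\<^esub>"] by (simp add: H.add.r_cancel_one)
  show ?thesis
    using \<open>finite A\<close> \<open>u \<in> A \<rightarrow> carrier G\<close>
  proof (induction A)
    case empty
    then show ?case by (simp add: zero)
  next
    case (insert a A)
    then have "u a \<in> carrier G" "u \<in> A \<rightarrow> carrier G" "(\<lambda>i. \<phi> (u i)) \<in> A \<rightarrow> carrier H"
      using closed by auto
    with insert show ?case
      by (simp add: add closed)
  qed
qed

lemma internal_direct_sum_subset:
  assumes "internal_direct_sum K M I N" "i \<in> I"
  shows "N i \<subseteq> carrier M"
  using assms subgroup.subset[of "N i" "add_monoid M"]
  by (auto simp: internal_direct_sum_def submodule_def)

lemma internal_direct_sum_zero:
  assumes "internal_direct_sum K M I N" "i \<in> I"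
  shows "\<zero>\<^bsub>M\<^esub> \<in> N i"
  using assms subgroup.one_closed[of "N i" "add_monoid M"]
  by (auto simp: internal_direct_sum_def submodule_def)

text \<open>The definition of a direct sum speaks of families indexed by all of \<open>I\<close> and summed over
  their supports; for calculations one wants to compare finite sums whose terms may vanish.
  Extension by zero passes from these to families on \<open>I\<close>.\<close>

lemma internal_direct_sum_unique:
  assumes "module K M" and N: "internal_direct_sum K M I N"
    and J: "finite J" "J \<subseteq> I"
    and c: "\<And>i. i \<in> J \<Longrightarrow> c i \<in> N i" and d: "\<And>i. i \<in> J \<Longrightarrow> d i \<in> N i"
    and eq: "(\<Oplus>\<^bsub>M\<^esub>i\<in>J. c i) = (\<Oplus>\<^bsub>M\<^esub>i\<in>J. d i)"
    and "i \<in> J"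
  shows "c i = d i"
proof -
  interpret module K M by fact
  define ext where "ext = (\<lambda>u. \<lambda>i\<in>I. if i \<in> J then u i else \<zero>\<^bsub>M\<^esub>)"
  define rep where "rep m u \<longleftrightarrow> u \<in> (\<Pi>\<^sub>E i \<in> I. N i) \<and> finite {i \<in> I. u i \<noteq> \<zero>\<^bsub>M\<^esub>} \<and>
     m = (\<Oplus>\<^bsub>M\<^esub>i \<in> {i \<in> I. u i \<noteq> \<zero>\<^bsub>M\<^esub>}. u i)" for m u
  have rep_ext: "rep (\<Oplus>\<^bsub>M\<^esub>i\<in>J. u i) (ext u)" if u: "\<And>i. i \<in> J \<Longrightarrow> u i \<in> N i" for u
  proof -
    have supp: "{i \<in> I. ext u i \<noteq> \<zero>\<^bsub>M\<^esub>} \<subseteq> J"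
      by (auto simp: ext_def)
    have u_carrier: "u \<in> J \<rightarrow> carrier M"
      using u J internal_direct_sum_subset[OF N] by blast
    have "(\<Oplus>\<^bsub>M\<^esub>i \<in> {i \<in> I. ext u i \<noteq> \<zero>\<^bsub>M\<^esub>}. ext u i) = (\<Oplus>\<^bsub>M\<^esub>i\<in>J. u i)"
      by (rule add.finprod_mono_neutral_cong_left)
        (use J supp u_carrier in \<open>auto simp: ext_def\<close>)
    moreover have "ext u \<in> (\<Pi>\<^sub>E i \<in> I. N i)"
      using u internal_direct_sum_zero[OF N] by (auto simp: ext_def)
    ultimately show ?thesis
      using finite_subset[OF supp \<open>finite J\<close>] by (simp add: rep_def)
  qed
  have "(\<Oplus>\<^bsub>M\<^esub>i\<in>J. d i) \<in> carrier M"
    using d J internal_direct_sum_subset[OF N] by (intro finsum_closed) blast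
  then have "\<exists>!u. rep (\<Oplus>\<^bsub>M\<^esub>i\<in>J. d i) u"
    using N by (simp add: internal_direct_sum_def rep_def)
  moreover have "rep (\<Oplus>\<^bsub>M\<^esub>i\<in>J. d i) (ext c)" "rep (\<Oplus>\<^bsub>M\<^esub>i\<in>J. d i) (ext d)"
    using rep_ext[of c] rep_ext[of d] c d eq by simp_all
  ultimately have "ext c i = ext d i"
    by metis
  then show ?thesis
    using \<open>i \<in> J\<close> J by (auto simp: ext_def)
qed

text \<open>Otherwise \<open>m\<close> would have two expansions over \<open>{s, t}\<close>, one concentrated in \<open>s\<close> and one
  in \<open>t\<close>. This is what makes the degree of a non-zero homogeneous morphism well defined.\<close>

lemma internal_direct_sum_disjoint:
  assumes "module K M" "internal_direct_sum K M I N"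
    and "s \<in> I" "t \<in> I" "m \<in> N s" "m \<in> N t" "m \<noteq> \<zero>\<^bsub>M\<^esub>"
  shows "s = t"
proof (rule ccontr)
  assume "s \<noteq> t"
  interpret module K M by fact
  have m: "m \<in> carrier M"
    using internal_direct_sum_subset[OF assms(2,3)] assms(5) by blast
  have sum: "(\<Oplus>\<^bsub>M\<^esub>i\<in>{s, t}. if i = r then m else \<zero>\<^bsub>M\<^esub>) = m" if "r \<in> {s, t}" for r
    using add.finprod_singleton_swap[of r "{s, t}" "\<lambda>_. m"] that m by simp
  have "(if s = s then m else \<zero>\<^bsub>M\<^esub>) = (if s = t then m else \<zero>\<^bsub>M\<^esub>)"
    by (rule internal_direct_sum_unique[OF assms(1,2), of "{s, t}"
          "\<lambda>i. if i = s then m else \<zero>\<^bsub>M\<^esub>" "\<lambda>i. if i = t then m else \<zero>\<^bsub>M\<^esub>"])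
      (use assms sum in \<open>auto intro: internal_direct_sum_zero\<close>)
  with \<open>s \<noteq> t\<close> \<open>m \<noteq> \<zero>\<^bsub>M\<^esub>\<close> show False by simp
qed

section \<open>Identities have degree one\<close>

lemma (in k_category) cmp_finsum_left:
  assumes "x \<in> Obj \<B>" "y \<in> Obj \<B>" "z \<in> Obj \<B>" "f \<in> carrier (Hom \<B> y x)"
    and "finite A" "u \<in> A \<rightarrow> carrier (Hom \<B> z y)"
  shows "cmp \<B> z y x (\<Oplus>\<^bsub>Hom \<B> z y\<^esub>i\<in>A. u i) f = (\<Oplus>\<^bsub>Hom \<B> z x\<^esub>i\<in>A. cmp \<B> z y x (u i) f)"
  by (rule abelian_group.additive_map_finsum)
    (use assms in \<open>auto intro: module.axioms hom_module cmp_closed cmp_add_left\<close>)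

lemma (in k_category) cmp_finsum_right:
  assumes "x \<in> Obj \<B>" "y \<in> Obj \<B>" "z \<in> Obj \<B>" "g \<in> carrier (Hom \<B> z y)"
    and "finite A" "u \<in> A \<rightarrow> carrier (Hom \<B> y x)"
  shows "cmp \<B> z y x g (\<Oplus>\<^bsub>Hom \<B> y x\<^esub>i\<in>A. u i) = (\<Oplus>\<^bsub>Hom \<B> z x\<^esub>i\<in>A. cmp \<B> z y x g (u i))"
  by (rule abelian_group.additive_map_finsum)
    (use assms in \<open>auto intro: module.axioms hom_module cmp_closed cmp_add_right\<close>)

context grading
begin

lemma component_subset:
  "\<lbrakk>x \<in> Obj \<B>; y \<in> Obj \<B>; s \<in> carrier \<Gamma>\<rbrakk> \<Longrightarrow> \<X> s y x \<subseteq> carrier (Hom \<B> y x)"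
  using internal_direct_sum_subset[OF decomposition] by simp

lemma component_zero:
  "\<lbrakk>x \<in> Obj \<B>; y \<in> Obj \<B>; s \<in> carrier \<Gamma>\<rbrakk> \<Longrightarrow> \<zero>\<^bsub>Hom \<B> y x\<^esub> \<in> \<X> s y x"
  using internal_direct_sum_zero[OF decomposition] by simp

text \<open>The products of \<open>f\<close> with the terms \<open>c s\<close> lie in pairwise distinct degrees \<open>s t\<close> and sum
  to \<open>f\<close>, which is homogeneous of degree \<open>t\<close>; so only the term with \<open>s = 1\<close> survives, and it is
  equal to \<open>f\<close>.\<close>

lemma Idn_component_fixes_homogeneous:
  assumes x: "x \<in> Obj \<B>" and S: "finite S" "S \<subseteq> carrier \<Gamma>" "\<one>\<^bsub>\<Gamma>\<^esub> \<in> S"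
    and c: "\<And>s. s \<in> S \<Longrightarrow> c s \<in> \<X> s x x"
    and Idn: "Idn \<B> x = (\<Oplus>\<^bsub>Hom \<B> x x\<^esub>s\<in>S. c s)"
    and t: "t \<in> carrier \<Gamma>" and f: "f \<in> \<X> t x x"
  shows "cmp \<B> x x x (c \<one>\<^bsub>\<Gamma>\<^esub>) f = f"
proof -
  interpret M: module K "Hom \<B> x x" using hom_module x by blast
  let ?shift = "\<lambda>s. s \<otimes>\<^bsub>\<Gamma>\<^esub> t"
  let ?d = "\<lambda>r. cmp \<B> x x x (c (r \<otimes>\<^bsub>\<Gamma>\<^esub> inv\<^bsub>\<Gamma>\<^esub> t)) f"
  have f_carrier: "f \<in> carrier (Hom \<B> x x)"
    using component_subset x t f by blast
  have c_carrier: "c \<in> S \<rightarrow> carrier (Hom \<B> x x)"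
    using component_subset c x S by blast
  have unshift: "?shift s \<otimes>\<^bsub>\<Gamma>\<^esub> inv\<^bsub>\<Gamma>\<^esub> t = s" if "s \<in> S" for s
    using that S t by (auto simp: \<Gamma>.m_assoc)
  have inj: "inj_on ?shift S"
    using unshift by (rule inj_on_inverseI)
  have t_mem: "t \<in> ?shift ` S"
    using S t by (intro image_eqI[of _ _ "\<one>\<^bsub>\<Gamma>\<^esub>"]) auto
  have d_degree: "?d r \<in> \<X> r x x" if "r \<in> ?shift ` S" for r
    using that unshift c S t f x by (auto intro!: cmp_degree)
  have "(\<Oplus>\<^bsub>Hom \<B> x x\<^esub>r\<in>?shift ` S. if r = t then f else \<zero>\<^bsub>Hom \<B> x x\<^esub>) = f"
    using M.add.finprod_singleton_swap[of t "?shift ` S" "\<lambda>_. f"] t_mem S f_carrier by simp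
  also have "f = cmp \<B> x x x (Idn \<B> x) f"
    using cmp_Idn_left x f_carrier by simp
  also have "\<dots> = (\<Oplus>\<^bsub>Hom \<B> x x\<^esub>s\<in>S. cmp \<B> x x x (c s) f)"
    unfolding Idn using x f_carrier S c_carrier by (simp add: cmp_finsum_left)
  also have "\<dots> = (\<Oplus>\<^bsub>Hom \<B> x x\<^esub>s\<in>S. ?d (?shift s))"
    using unshift c_carrier x f_carrier by (intro M.finsum_cong') (auto intro!: cmp_closed)
  also have "\<dots> = (\<Oplus>\<^bsub>Hom \<B> x x\<^esub>r\<in>?shift ` S. ?d r)"
    by (rule M.finsum_reindex[symmetric, OF _ inj])
      (use unshift c_carrier x f_carrier in \<open>auto intro!: cmp_closed\<close>)
  finally have sums: "(\<Oplus>\<^bsub>Hom \<B> x x\<^esub>r\<in>?shift ` S. if r = t then f else \<zero>\<^bsub>Hom \<B> x x\<^esub>)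
      = (\<Oplus>\<^bsub>Hom \<B> x x\<^esub>r\<in>?shift ` S. ?d r)" .
  have "(if t = t then f else \<zero>\<^bsub>Hom \<B> x x\<^esub>) = ?d t"
    by (rule internal_direct_sum_unique[OF M.module_axioms decomposition[OF x x] _ _ _ d_degree sums t_mem])
      (use S t f x component_zero in auto)
  then show ?thesis
    using t by simp
qed

lemma homogeneous_decomposition:
  assumes "x \<in> Obj \<B>" "y \<in> Obj \<B>" "m \<in> carrier (Hom \<B> y x)"
  obtains S c where "finite S" "S \<subseteq> carrier \<Gamma>" "\<forall>s \<in> carrier \<Gamma>. c s \<in> \<X> s y x"
    "\<forall>s \<in> carrier \<Gamma> - S. c s = \<zero>\<^bsub>Hom \<B> y x\<^esub>"
    "m = (\<Oplus>\<^bsub>Hom \<B> y x\<^esub>s\<in>S. c s)"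
proof -
  obtain c where c: "c \<in> (\<Pi>\<^sub>E s \<in> carrier \<Gamma>. \<X> s y x)"
      "finite {s \<in> carrier \<Gamma>. c s \<noteq> \<zero>\<^bsub>Hom \<B> y x\<^esub>}"
      "m = (\<Oplus>\<^bsub>Hom \<B> y x\<^esub>s \<in> {s \<in> carrier \<Gamma>. c s \<noteq> \<zero>\<^bsub>Hom \<B> y x\<^esub>}. c s)"
    using decomposition[OF assms(1,2), unfolded internal_direct_sum_def,
        THEN conjunct2, THEN bspec, OF assms(3)]
    by (elim ex1E conjE)
  show thesis
    by (rule that[OF c(2) _ _ _ c(3)]) (use c(1) in auto)
qed

text \<open>The component of degree \<open>1\<close> of the identity acts on the left as an identity, so it is
  equal to its product with the identity.\<close>

lemma Idn_degree_one:
  assumes x: "x \<in> Obj \<B>"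
  shows "Idn \<B> x \<in> \<X> \<one>\<^bsub>\<Gamma>\<^esub> x x"
proof -
  interpret M: module K "Hom \<B> x x" using hom_module x by blast
  obtain S c where S: "finite S" "S \<subseteq> carrier \<Gamma>"
    and c: "\<forall>s \<in> carrier \<Gamma>. c s \<in> \<X> s x x"
    and c_zero: "\<forall>s \<in> carrier \<Gamma> - S. c s = \<zero>\<^bsub>Hom \<B> x x\<^esub>"
    and Idn: "Idn \<B> x = (\<Oplus>\<^bsub>Hom \<B> x x\<^esub>s\<in>S. c s)"
    using homogeneous_decomposition[OF x x Idn_closed[OF x]] by metis
  \<comment> \<open>The support of the identity is not yet known to contain \<open>1\<close>.\<close>
  let ?T = "insert \<one>\<^bsub>\<Gamma>\<^esub> S"
  have T: "finite ?T" "?T \<subseteq> carrier \<Gamma>" using S by auto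
  have c_carrier: "c \<in> ?T \<rightarrow> carrier (Hom \<B> x x)"
    using component_subset[OF x x] c T by blast
  have Idn_T: "Idn \<B> x = (\<Oplus>\<^bsub>Hom \<B> x x\<^esub>s\<in>?T. c s)"
    unfolding Idn
    by (rule M.add.finprod_mono_neutral_cong_left) (use T c_zero c_carrier in auto)
  have fixes_c: "cmp \<B> x x x (c \<one>\<^bsub>\<Gamma>\<^esub>) (c s) = c s" if "s \<in> ?T" for s
    by (rule Idn_component_fixes_homogeneous[OF x T _ _ Idn_T, of s]) (use that T c in auto)
  have "c \<one>\<^bsub>\<Gamma>\<^esub> = cmp \<B> x x x (c \<one>\<^bsub>\<Gamma>\<^esub>) (Idn \<B> x)"
    using cmp_Idn_right x c_carrier by simp
  also have "\<dots> = (\<Oplus>\<^bsub>Hom \<B> x x\<^esub>s\<in>?T. cmp \<B> x x x (c \<one>\<^bsub>\<Gamma>\<^esub>) (c s))"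
    unfolding Idn_T by (rule cmp_finsum_right) (use x T c_carrier in auto)
  also have "\<dots> = Idn \<B> x"
    unfolding Idn_T using fixes_c c_carrier by (intro M.finsum_cong') auto
  finally show ?thesis
    using c by force
qed

section \<open>The smash product category\<close>

lemma telescope:
  assumes "l \<in> carrier \<Gamma>" "h \<in> carrier \<Gamma>" "g \<in> carrier \<Gamma>"
  shows "(inv\<^bsub>\<Gamma>\<^esub> l \<otimes>\<^bsub>\<Gamma>\<^esub> h) \<otimes>\<^bsub>\<Gamma>\<^esub> (inv\<^bsub>\<Gamma>\<^esub> h \<otimes>\<^bsub>\<Gamma>\<^esub> g) = inv\<^bsub>\<Gamma>\<^esub> l \<otimes>\<^bsub>\<Gamma>\<^esub> g"
proof -
  have "h \<otimes>\<^bsub>\<Gamma>\<^esub> (inv\<^bsub>\<Gamma>\<^esub> h \<otimes>\<^bsub>\<Gamma>\<^esub> g) = g"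
    using assms by (simp add: \<Gamma>.m_assoc[symmetric])
  then show ?thesis
    using assms by (simp add: \<Gamma>.m_assoc)
qed

lemma smash_product_k_category: "k_category K (smash_product \<B> \<Gamma> \<X>)"
proof -
  have sub: "m \<in> carrier (Hom \<B> c b)"
    if "m \<in> \<X> (inv\<^bsub>\<Gamma>\<^esub> h \<otimes>\<^bsub>\<Gamma>\<^esub> g) c b" "b \<in> Obj \<B>" "c \<in> Obj \<B>" "g \<in> carrier \<Gamma>" "h \<in> carrier \<Gamma>"
    for m b c g h
    using that component_subset by blast
  have degree: "cmp \<B> d c b v u \<in> \<X> (inv\<^bsub>\<Gamma>\<^esub> l \<otimes>\<^bsub>\<Gamma>\<^esub> g) d b"
    if "b \<in> Obj \<B>" "c \<in> Obj \<B>" "d \<in> Obj \<B>" "g \<in> carrier \<Gamma>" "h \<in> carrier \<Gamma>" "l \<in> carrier \<Gamma>"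
      "u \<in> \<X> (inv\<^bsub>\<Gamma>\<^esub> h \<otimes>\<^bsub>\<Gamma>\<^esub> g) c b" "v \<in> \<X> (inv\<^bsub>\<Gamma>\<^esub> l \<otimes>\<^bsub>\<Gamma>\<^esub> h) d c" for b c d g h l u v
    using cmp_degree[of b c d "inv\<^bsub>\<Gamma>\<^esub> h \<otimes>\<^bsub>\<Gamma>\<^esub> g" "inv\<^bsub>\<Gamma>\<^esub> l \<otimes>\<^bsub>\<Gamma>\<^esub> h" u v] that
    by (simp add: telescope)
  have mods: "module K ((Hom \<B> c b)\<lparr>carrier := \<X> s c b\<rparr>)"
    if "b \<in> Obj \<B>" "c \<in> Obj \<B>" "s \<in> carrier \<Gamma>" for b c s
    using that decomposition[of b c] hom_module[of b c]
    by (intro submodule.submodule_is_module) (auto simp: internal_direct_sum_def)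
  show ?thesis
  proof (intro k_category.intro k_category_axioms.intro cring_axioms, goal_cases)
    case (2 x y z f g)
    then show ?case by (auto simp: smash_product_def intro: degree)
  qed (auto simp: smash_product_def Idn_degree_one dest!: sub intro: mods cmp_add_right
      cmp_add_left cmp_smult_right cmp_smult_left cmp_assoc cmp_Idn_left cmp_Idn_right)
qed

end

section \<open>Walks of the smash product\<close>

lemma nonzero_walk_single:
  "nonzero_walk \<B> [(f, \<epsilon>)] x y \<longleftrightarrow>
     nonzero_morphism \<B> f \<and> \<epsilon> \<in> {1, -1} \<and> step_source (f, \<epsilon>) = x \<and> step_target (f, \<epsilon>) = y"
  by (auto simp: nonzero_walk_def)

lemma nonzero_walk_Cons:
  assumes "w \<noteq> []"
  shows "nonzero_walk \<B> ((f, \<epsilon>) # w) x y \<longleftrightarrow>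
     nonzero_morphism \<B> f \<and> \<epsilon> \<in> {1, -1} \<and> step_target (f, \<epsilon>) = y \<and>
     nonzero_walk \<B> w x (step_source (f, \<epsilon>))"
proof -
  have chain: "(\<forall>i. Suc i < length ((f, \<epsilon>) # w) \<longrightarrow>
          step_source (((f, \<epsilon>) # w) ! i) = step_target (((f, \<epsilon>) # w) ! Suc i)) \<longleftrightarrow>
        step_source (f, \<epsilon>) = step_target (hd w) \<and>
        (\<forall>i. Suc i < length w \<longrightarrow> step_source (w ! i) = step_target (w ! Suc i))"
    using assms by (cases w) (simp_all add: All_less_Suc2)
  show ?thesis
    unfolding nonzero_walk_def chain using assms by auto
qed

context grading
begin

lemma degree_of_eq:
  assumes "nonzero_morphism \<B> f" "s \<in> carrier \<Gamma>" "mor f \<in> \<X> s (target f) (source f)"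
  shows "degree_of \<Gamma> \<X> f = s"
  unfolding degree_of_def
proof (rule the_equality)
  show "s \<in> carrier \<Gamma> \<and> mor f \<in> \<X> s (target f) (source f)"
    using assms by simp
next
  fix t assume "t \<in> carrier \<Gamma> \<and> mor f \<in> \<X> t (target f) (source f)"
  then have t: "t \<in> carrier \<Gamma>" "mor f \<in> \<X> t (target f) (source f)" by auto
  have f: "source f \<in> Obj \<B>" "target f \<in> Obj \<B>" "mor f \<noteq> \<zero>\<^bsub>Hom \<B> (target f) (source f)\<^esub>"
    using assms(1) by (auto simp: nonzero_morphism_def)
  show "t = s"
    by (rule internal_direct_sum_disjoint[OF hom_module[OF f(1,2)] decomposition[OF f(1,2)]
          t(1) assms(2) t(2) assms(3) f(3)])
qed

lemma degree_of_closed: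
  assumes "nonzero_morphism \<B> f" "homogeneous \<Gamma> \<X> f"
  shows "degree_of \<Gamma> \<X> f \<in> carrier \<Gamma>" "mor f \<in> \<X> (degree_of \<Gamma> \<X> f) (target f) (source f)"
proof -
  obtain s where s: "s \<in> carrier \<Gamma>" "mor f \<in> \<X> s (target f) (source f)"
    using assms(2) by (auto simp: homogeneous_def)
  then show "degree_of \<Gamma> \<X> f \<in> carrier \<Gamma>" "mor f \<in> \<X> (degree_of \<Gamma> \<X> f) (target f) (source f)"
    using degree_of_eq[OF assms(1) s] by simp_all
qed

text \<open>This is the dictionary between the two categories: a non-zero homogeneous morphism of \<open>\<B>\<close>
  has one copy in the smash product for each pair of group components that its degree allows.\<close>

lemma nonzero_morphism_smash_product:
  "nonzero_morphism (smash_product \<B> \<Gamma> \<X>) (Arrow (b, g) (c, h) m) \<longleftrightarrow>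
     g \<in> carrier \<Gamma> \<and> h \<in> carrier \<Gamma> \<and> nonzero_morphism \<B> (Arrow b c m) \<and>
     homogeneous \<Gamma> \<X> (Arrow b c m) \<and> degree_of \<Gamma> \<X> (Arrow b c m) = inv\<^bsub>\<Gamma>\<^esub> h \<otimes>\<^bsub>\<Gamma>\<^esub> g"
  (is "?L \<longleftrightarrow> ?R")
proof
  assume L: ?L
  then have mem: "b \<in> Obj \<B>" "c \<in> Obj \<B>" "g \<in> carrier \<Gamma>" "h \<in> carrier \<Gamma>"
      "m \<in> \<X> (inv\<^bsub>\<Gamma>\<^esub> h \<otimes>\<^bsub>\<Gamma>\<^esub> g) c b" and "m \<noteq> \<zero>\<^bsub>Hom \<B> c b\<^esub>"
    by (auto simp: nonzero_morphism_def smash_product_def)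
  then have nz: "nonzero_morphism \<B> (Arrow b c m)"
    using component_subset[of b c "inv\<^bsub>\<Gamma>\<^esub> h \<otimes>\<^bsub>\<Gamma>\<^esub> g"] by (simp add: nonzero_morphism_def subset_iff)
  have deg: "degree_of \<Gamma> \<X> (Arrow b c m) = inv\<^bsub>\<Gamma>\<^esub> h \<otimes>\<^bsub>\<Gamma>\<^esub> g"
    by (rule degree_of_eq[OF nz]) (use mem in simp_all)
  have "homogeneous \<Gamma> \<X> (Arrow b c m)"
    unfolding homogeneous_def
    by (rule bexI[of _ "inv\<^bsub>\<Gamma>\<^esub> h \<otimes>\<^bsub>\<Gamma>\<^esub> g"]) (use mem in simp_all)
  with mem nz deg show ?R by simp
next
  assume R: ?R
  then show ?L
    using degree_of_closed(2)[of "Arrow b c m"]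
    by (simp add: nonzero_morphism_def smash_product_def)
qed

text \<open>The sign is absorbed: a step against \<open>F\<close> starts at the target of \<open>F\<close>, and inverting the
  degree \<open>h\<inverse> g\<close> to \<open>g\<inverse> h\<close> exchanges the ends in the same way.\<close>

lemma project_step:
  assumes "nonzero_morphism (smash_product \<B> \<Gamma> \<X>) F" "\<epsilon> \<in> {1, -1}"
  obtains f where "nonzero_morphism \<B> f" "homogeneous \<Gamma> \<X> f"
    "step_source (f, \<epsilon>) = fst (step_source (F, \<epsilon>))"
    "step_target (f, \<epsilon>) = fst (step_target (F, \<epsilon>))"
    "snd (step_source (F, \<epsilon>)) \<in> carrier \<Gamma>" "snd (step_target (F, \<epsilon>)) \<in> carrier \<Gamma>"
    "degree_of \<Gamma> \<X> f [^]\<^bsub>\<Gamma>\<^esub> \<epsilon> =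
       inv\<^bsub>\<Gamma>\<^esub> (snd (step_target (F, \<epsilon>))) \<otimes>\<^bsub>\<Gamma>\<^esub> snd (step_source (F, \<epsilon>))"
proof -
  obtain b g c h m where F: "F = Arrow (b, g) (c, h) m"
    by (metis arrow.exhaust surj_pair)
  note R = assms(1)[unfolded F nonzero_morphism_smash_product]
  show thesis
    by (rule that[of "Arrow b c m"])
      (use R assms(2) in \<open>auto simp: F \<Gamma>.int_pow_neg \<Gamma>.inv_mult_group\<close>)
qed

text \<open>The component \<open>g\<close> at the start of the step is prescribed. The component \<open>t\<close> at its end must
  satisfy \<open>t\<inverse> g = d\<close>, where \<open>d\<close> is the degree of the step, whence \<open>t = g d\<inverse>\<close>.\<close>

lemma lift_step:
  assumes f: "nonzero_morphism \<B> f" "homogeneous \<Gamma> \<X> f" and \<epsilon>: "\<epsilon> \<in> {1, -1}"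
    and g: "g \<in> carrier \<Gamma>"
  obtains F where "nonzero_morphism (smash_product \<B> \<Gamma> \<X>) F"
    "step_source (F, \<epsilon>) = (step_source (f, \<epsilon>), g)"
    "step_target (F, \<epsilon>) = (step_target (f, \<epsilon>), g \<otimes>\<^bsub>\<Gamma>\<^esub> inv\<^bsub>\<Gamma>\<^esub> (degree_of \<Gamma> \<X> f [^]\<^bsub>\<Gamma>\<^esub> \<epsilon>))"
proof -
  obtain b c m where f_eq: "f = Arrow b c m"
    by (rule arrow.exhaust)
  let ?s = "degree_of \<Gamma> \<X> f"
  have s: "?s \<in> carrier \<Gamma>"
    using degree_of_closed f by blast
  show thesis
  proof (cases "\<epsilon> = 1")
    case True
    have "inv\<^bsub>\<Gamma>\<^esub> (g \<otimes>\<^bsub>\<Gamma>\<^esub> inv\<^bsub>\<Gamma>\<^esub> ?s) \<otimes>\<^bsub>\<Gamma>\<^esub> g = ?s"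
      using s g by (simp add: \<Gamma>.inv_mult_group \<Gamma>.m_assoc)
    with True f s g show thesis
      by (intro that[of "Arrow (b, g) (c, g \<otimes>\<^bsub>\<Gamma>\<^esub> inv\<^bsub>\<Gamma>\<^esub> ?s) m"])
        (simp_all add: f_eq nonzero_morphism_smash_product)
  next
    case False
    then have "\<epsilon> = -1" using \<epsilon> by simp
    have "inv\<^bsub>\<Gamma>\<^esub> g \<otimes>\<^bsub>\<Gamma>\<^esub> (g \<otimes>\<^bsub>\<Gamma>\<^esub> ?s) = ?s"
      using s g by (simp add: \<Gamma>.m_assoc[symmetric])
    with \<open>\<epsilon> = -1\<close> f s g show thesis
      by (intro that[of "Arrow (b, g \<otimes>\<^bsub>\<Gamma>\<^esub> ?s) (c, g) m"])
        (simp_all add: f_eq nonzero_morphism_smash_product \<Gamma>.int_pow_neg)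
  qed
qed

lemma project_walk:
  assumes "nonzero_walk (smash_product \<B> \<Gamma> \<X>) W p q"
  shows "snd p \<in> carrier \<Gamma> \<and> snd q \<in> carrier \<Gamma> \<and>
    (\<exists>w. nonzero_walk \<B> w (fst p) (fst q) \<and> homogeneous_walk \<Gamma> \<X> w \<and>
         walk_deg \<Gamma> \<X> w = inv\<^bsub>\<Gamma>\<^esub> (snd q) \<otimes>\<^bsub>\<Gamma>\<^esub> snd p)"
proof -
  have "W \<noteq> []"
    using assms by (simp add: nonzero_walk_def)
  then show ?thesis
    using assms
  proof (induction W arbitrary: q rule: list_nonempty_induct)
    case (single S)
    obtain F \<epsilon> where S: "S = (F, \<epsilon>)" by (rule prod.exhaust)
    from single have F: "nonzero_morphism (smash_product \<B> \<Gamma> \<X>) F" and \<epsilon>: "\<epsilon> \<in> {1, -1}"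
      and ends: "step_source (F, \<epsilon>) = p" "step_target (F, \<epsilon>) = q"
      unfolding S nonzero_walk_single by blast+
    obtain f where f: "nonzero_morphism \<B> f" "homogeneous \<Gamma> \<X> f"
      "step_source (f, \<epsilon>) = fst p" "step_target (f, \<epsilon>) = fst q"
      "snd p \<in> carrier \<Gamma>" "snd q \<in> carrier \<Gamma>"
      "degree_of \<Gamma> \<X> f [^]\<^bsub>\<Gamma>\<^esub> \<epsilon> = inv\<^bsub>\<Gamma>\<^esub> (snd q) \<otimes>\<^bsub>\<Gamma>\<^esub> snd p"
      using project_step[OF F \<epsilon>] unfolding ends by metis
    then have "nonzero_walk \<B> [(f, \<epsilon>)] (fst p) (fst q)" "homogeneous_walk \<Gamma> \<X> [(f, \<epsilon>)]"
      "walk_deg \<Gamma> \<X> [(f, \<epsilon>)] = inv\<^bsub>\<Gamma>\<^esub> (snd q) \<otimes>\<^bsub>\<Gamma>\<^esub> snd p"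
      using \<epsilon> unfolding nonzero_walk_single by (auto simp: homogeneous_walk_def)
    with f show ?case by blast
  next
    case (cons S W)
    obtain F \<epsilon> where S: "S = (F, \<epsilon>)" by (rule prod.exhaust)
    define r where "r = step_source (F, \<epsilon>)"
    from cons have F: "nonzero_morphism (smash_product \<B> \<Gamma> \<X>) F" and \<epsilon>: "\<epsilon> \<in> {1, -1}"
      and "end": "step_target (F, \<epsilon>) = q" and W: "nonzero_walk (smash_product \<B> \<Gamma> \<X>) W p r"
      unfolding S r_def nonzero_walk_Cons[OF cons.hyps(1)] by blast+
    obtain f where f: "nonzero_morphism \<B> f" "homogeneous \<Gamma> \<X> f"
      "step_source (f, \<epsilon>) = fst r" "step_target (f, \<epsilon>) = fst q"
      "snd r \<in> carrier \<Gamma>" "snd q \<in> carrier \<Gamma>"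
      "degree_of \<Gamma> \<X> f [^]\<^bsub>\<Gamma>\<^esub> \<epsilon> = inv\<^bsub>\<Gamma>\<^esub> (snd q) \<otimes>\<^bsub>\<Gamma>\<^esub> snd r"
      using project_step[OF F \<epsilon>] unfolding "end" r_def[symmetric] by metis
    obtain w where p: "snd p \<in> carrier \<Gamma>" and w: "nonzero_walk \<B> w (fst p) (fst r)"
      "homogeneous_walk \<Gamma> \<X> w" "walk_deg \<Gamma> \<X> w = inv\<^bsub>\<Gamma>\<^esub> (snd r) \<otimes>\<^bsub>\<Gamma>\<^esub> snd p"
      using cons.IH[OF W] by blast
    have "w \<noteq> []"
      using w by (simp add: nonzero_walk_def)
    have "nonzero_walk \<B> ((f, \<epsilon>) # w) (fst p) (fst q)"
      using f \<epsilon> w unfolding nonzero_walk_Cons[OF \<open>w \<noteq> []\<close>] by simp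
    moreover have "homogeneous_walk \<Gamma> \<X> ((f, \<epsilon>) # w)"
      using f w by (simp add: homogeneous_walk_def)
    moreover have "walk_deg \<Gamma> \<X> ((f, \<epsilon>) # w) = inv\<^bsub>\<Gamma>\<^esub> (snd q) \<otimes>\<^bsub>\<Gamma>\<^esub> snd p"
      using f p w by (simp add: telescope)
    ultimately show ?case
      using p f by blast
  qed
qed

lemma walk_deg_closed:
  assumes "nonzero_walk \<B> w x y" "homogeneous_walk \<Gamma> \<X> w"
  shows "walk_deg \<Gamma> \<X> w \<in> carrier \<Gamma>"
proof -
  have "\<forall>(f, \<epsilon>) \<in> set w. nonzero_morphism \<B> f \<and> homogeneous \<Gamma> \<X> f"
    using assms by (auto simp: nonzero_walk_def homogeneous_walk_def)
  then show ?thesis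
    by (induction w) (auto intro!: \<Gamma>.m_closed \<Gamma>.int_pow_closed degree_of_closed)
qed

lemma lift_walk:
  assumes "nonzero_walk \<B> w x y" "homogeneous_walk \<Gamma> \<X> w" and g: "g \<in> carrier \<Gamma>"
  shows "\<exists>W. nonzero_walk (smash_product \<B> \<Gamma> \<X>) W (x, g)
    (y, g \<otimes>\<^bsub>\<Gamma>\<^esub> inv\<^bsub>\<Gamma>\<^esub> (walk_deg \<Gamma> \<X> w))"
proof -
  have "w \<noteq> []"
    using assms by (simp add: nonzero_walk_def)
  then show ?thesis
    using assms(1,2)
  proof (induction w arbitrary: y rule: list_nonempty_induct)
    case (single s)
    obtain f \<epsilon> where s: "s = (f, \<epsilon>)" by (rule prod.exhaust)
    from single have f: "nonzero_morphism \<B> f" "homogeneous \<Gamma> \<X> f" and \<epsilon>: "\<epsilon> \<in> {1, -1}"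
      and ends: "step_source (f, \<epsilon>) = x" "step_target (f, \<epsilon>) = y"
      unfolding s nonzero_walk_single by (auto simp: homogeneous_walk_def)
    have "degree_of \<Gamma> \<X> f \<in> carrier \<Gamma>"
      using degree_of_closed f by blast
    then have deg: "walk_deg \<Gamma> \<X> [s] = degree_of \<Gamma> \<X> f [^]\<^bsub>\<Gamma>\<^esub> \<epsilon>"
      by (simp add: s)
    show ?case
      using lift_step[OF f \<epsilon> g] \<epsilon> unfolding deg ends by (metis nonzero_walk_single)
  next
    case (cons s w)
    obtain f \<epsilon> where s: "s = (f, \<epsilon>)" by (rule prod.exhaust)
    define z where "z = step_source (f, \<epsilon>)"
    from cons have f: "nonzero_morphism \<B> f" "homogeneous \<Gamma> \<X> f" and \<epsilon>: "\<epsilon> \<in> {1, -1}"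
      and "end": "step_target (f, \<epsilon>) = y"
      and w: "nonzero_walk \<B> w x z" "homogeneous_walk \<Gamma> \<X> w"
      unfolding s z_def nonzero_walk_Cons[OF cons.hyps(1)] by (auto simp: homogeneous_walk_def)
    let ?d = "walk_deg \<Gamma> \<X> w" and ?e = "degree_of \<Gamma> \<X> f [^]\<^bsub>\<Gamma>\<^esub> \<epsilon>"
    have d: "?d \<in> carrier \<Gamma>" and e: "?e \<in> carrier \<Gamma>"
      using walk_deg_closed[OF w] degree_of_closed[OF f] by auto
    obtain W where W: "nonzero_walk (smash_product \<B> \<Gamma> \<X>) W (x, g) (z, g \<otimes>\<^bsub>\<Gamma>\<^esub> inv\<^bsub>\<Gamma>\<^esub> ?d)"
      using cons.IH[OF w] by blast
    then have "W \<noteq> []"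
      by (simp add: nonzero_walk_def)
    have "g \<otimes>\<^bsub>\<Gamma>\<^esub> inv\<^bsub>\<Gamma>\<^esub> ?d \<in> carrier \<Gamma>"
      using g d by simp
    then obtain F where F: "nonzero_morphism (smash_product \<B> \<Gamma> \<X>) F"
      "step_source (F, \<epsilon>) = (z, g \<otimes>\<^bsub>\<Gamma>\<^esub> inv\<^bsub>\<Gamma>\<^esub> ?d)"
      "step_target (F, \<epsilon>) = (y, g \<otimes>\<^bsub>\<Gamma>\<^esub> inv\<^bsub>\<Gamma>\<^esub> ?d \<otimes>\<^bsub>\<Gamma>\<^esub> inv\<^bsub>\<Gamma>\<^esub> ?e)"
      using lift_step[OF f \<epsilon>] unfolding "end" z_def[symmetric] by metis
    have "g \<otimes>\<^bsub>\<Gamma>\<^esub> inv\<^bsub>\<Gamma>\<^esub> ?d \<otimes>\<^bsub>\<Gamma>\<^esub> inv\<^bsub>\<Gamma>\<^esub> ?e = g \<otimes>\<^bsub>\<Gamma>\<^esub> inv\<^bsub>\<Gamma>\<^esub> (walk_deg \<Gamma> \<X> (s # w))"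
      using g d e by (simp add: s \<Gamma>.inv_mult_group \<Gamma>.m_assoc)
    then have "nonzero_walk (smash_product \<B> \<Gamma> \<X>) ((F, \<epsilon>) # W) (x, g)
        (y, g \<otimes>\<^bsub>\<Gamma>\<^esub> inv\<^bsub>\<Gamma>\<^esub> (walk_deg \<Gamma> \<X> (s # w)))"
      using F W \<epsilon> unfolding nonzero_walk_Cons[OF \<open>W \<noteq> []\<close>] by simp
    then show ?case by blast
  qed
qed

lemma connected_smash_product_iff:
  "connected_kcat (smash_product \<B> \<Gamma> \<X>) \<longleftrightarrow> connected_grading \<B> \<Gamma> \<X>"
proof
  assume conn: "connected_kcat (smash_product \<B> \<Gamma> \<X>)"
  show "connected_grading \<B> \<Gamma> \<X>"
    unfolding connected_grading_def
  proof (intro ballI)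
    fix x y g assume "x \<in> Obj \<B>" "y \<in> Obj \<B>" and g: "g \<in> carrier \<Gamma>"
    \<comment> \<open>Ending at the component \<open>1\<close> makes the degree of the projected walk equal to \<open>g\<close>.\<close>
    then obtain W where "nonzero_walk (smash_product \<B> \<Gamma> \<X>) W (x, g) (y, \<one>\<^bsub>\<Gamma>\<^esub>)"
      using conn by (fastforce simp: connected_kcat_def smash_product_def)
    from project_walk[OF this]
    show "\<exists>w. nonzero_walk \<B> w x y \<and> homogeneous_walk \<Gamma> \<X> w \<and> walk_deg \<Gamma> \<X> w = g"
      using g by simp
  qed
next
  assume conn: "connected_grading \<B> \<Gamma> \<X>"
  show "connected_kcat (smash_product \<B> \<Gamma> \<X>)"
    unfolding connected_kcat_def
  proof (intro ballI)
    fix p q assume "p \<in> Obj (smash_product \<B> \<Gamma> \<X>)" "q \<in> Obj (smash_product \<B> \<Gamma> \<X>)"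
    then obtain x g y h where p: "p = (x, g)" and q: "q = (y, h)"
      and mem: "x \<in> Obj \<B>" "y \<in> Obj \<B>" "g \<in> carrier \<Gamma>" "h \<in> carrier \<Gamma>"
      by (auto simp: smash_product_def)
    then have "inv\<^bsub>\<Gamma>\<^esub> h \<otimes>\<^bsub>\<Gamma>\<^esub> g \<in> carrier \<Gamma>" by simp
    then obtain w where w: "nonzero_walk \<B> w x y" "homogeneous_walk \<Gamma> \<X> w"
      and deg: "walk_deg \<Gamma> \<X> w = inv\<^bsub>\<Gamma>\<^esub> h \<otimes>\<^bsub>\<Gamma>\<^esub> g"
      using conn mem unfolding connected_grading_def by blast
    have "g \<otimes>\<^bsub>\<Gamma>\<^esub> inv\<^bsub>\<Gamma>\<^esub> (walk_deg \<Gamma> \<X> w) = h"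
      using mem by (simp add: deg \<Gamma>.inv_mult_group \<Gamma>.m_assoc[symmetric])
    then show "\<exists>w. nonzero_walk (smash_product \<B> \<Gamma> \<X>) w p q"
      using lift_walk[OF w mem(3)] by (simp add: p q)
  qed
qed

end

theorem proposition2p8:
  fixes K :: "('k, 'r) ring_scheme"
    and \<B> :: "('k, 'o, 'm) kcat"
    and \<Gamma> :: "('g, 'h) monoid_scheme"
    and \<X> :: "'g \<Rightarrow> 'o \<Rightarrow> 'o \<Rightarrow> 'm set"
  assumes "cring K"
    and "k_category K \<B>"
    and "group \<Gamma>"
    and "grading K \<B> \<Gamma> \<X>"
  shows "k_category K (smash_product \<B> \<Gamma> \<X>) \<and> connected_kcat (smash_product \<B> \<Gamma> \<X>)
         \<longleftrightarrow> connected_grading \<B> \<Gamma> \<X>"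
  using grading.smash_product_k_category[OF assms(4)] grading.connected_smash_product_iff[OF assms(4)]
  by blast

end
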